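(* Let $(D_p)_{p=1}^\infty$, $D_p=\{a_n^{(p)}\}_{n\in\mathbb{N}}\subset\mathbb{R}^k$, be a sequence of almost periodic discrete multiple sets, and let $D=\{b_n\}_{n\in\mathbb{N}}\subset\mathbb{R}^k$ be a discrete multiple set such that $\mathrm{dist}(D_p,D)\to 0$ as $p\to\infty$. Then $D$ is almost periodic.
   Context: A discrete multiple set $\{a_n\}_{n\in\mathbb{N}}$ in $\mathbb{R}^k$ is the value set, counted with multiplicity, of a sequence $(a_n)_{n=1}^\infty\subset\mathbb{R}^k$ having no finite limit points (equivalently, every bounded set contains $a_n$ for only finitely many indices $n$). Two sequences differing by a permutation of indices define the same discrete multiple set. For discrete multiple sets put $\mathrm{dist}(\{a_n\}_{n\in\mathbb{N}},\{b_n\}_{n\in\mathbb{N}})=\inf_{\sigma}\sup_{n\in\mathbb{N}}|a_n-b_{\sigma(n)}|\in[0,\infty]$, the infimum over all bijections $\sigma:\mathbb{N}\to\mathbb{N}$, where $|\cdot|$ is the Euclidean norm. A vector $\tau\in\mathbb{R}^k$ is an $\varepsilon$-almost period of $\{a_n\}_{n\in\mathbb{N}}$ if $\mathrm{dist}(\{a_n\}_{n\in\mathbb{N}},\{a_n+\tau\}_{n\in\mathbb{N}})<\varepsilon$. A set $E\subset\mathbb{R}^k$ is relatively dense if there is $L<\infty$ such that every ball of radius $L$ in $\mathbb{R}^k$ meets $E$. A discrete multiple set is almost periodic if for each $\varepsilon>0$ the set of its $\varepsilon$-almost periods is relatively dense in $\mathbb{R}^k$. *)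

theory Defs
  imports "HOL-Analysis.Analysis"
begin

text \<open>
  A discrete multiple set is represented by a sequence enumerating it with multiplicity.
  Sequences that differ by a permutation of the indices stand for the same discrete multiple set;
  the permutation lemmas below show that the notions do not depend on the enumeration.
\<close>

definition discrete_multiset :: "(nat \<Rightarrow> 'a::euclidean_space) \<Rightarrow> bool" where
  "discrete_multiset a \<longleftrightarrow> (\<forall>B. bounded B \<longrightarrow> finite {n. a n \<in> B})"

definition mset_dist :: "(nat \<Rightarrow> 'a::euclidean_space) \<Rightarrow> (nat \<Rightarrow> 'a) \<Rightarrow> ennreal" where
  "mset_dist a b = (INF \<sigma>\<in>{\<sigma> :: nat \<Rightarrow> nat. bij \<sigma>}. SUP n. ennreal (norm (a n - b (\<sigma> n))))"

definition almost_period :: "real \<Rightarrow> (nat \<Rightarrow> 'a::euclidean_space) \<Rightarrow> 'a \<Rightarrow> bool" where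
  "almost_period \<epsilon> a \<tau> \<longleftrightarrow> mset_dist a (\<lambda>n. a n + \<tau>) < ennreal \<epsilon>"

definition relatively_dense :: "'a::euclidean_space set \<Rightarrow> bool" where
  "relatively_dense E \<longleftrightarrow> (\<exists>L::real. \<forall>x. ball x L \<inter> E \<noteq> {})"

definition almost_periodic :: "(nat \<Rightarrow> 'a::euclidean_space) \<Rightarrow> bool" where
  "almost_periodic a \<longleftrightarrow> (\<forall>\<epsilon>>0. relatively_dense {\<tau>. almost_period \<epsilon> a \<tau>})"

lemma discrete_multiset_iff_no_limit_point:
  "discrete_multiset a \<longleftrightarrow> \<not> (\<exists>l r. strict_mono r \<and> (a \<circ> r) \<longlonglongrightarrow> l)"
proof
  assume a: "discrete_multiset a"
  show "\<not> (\<exists>l r. strict_mono r \<and> (a \<circ> r) \<longlonglongrightarrow> l)"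
  proof
    assume "\<exists>l r. strict_mono r \<and> (a \<circ> r) \<longlonglongrightarrow> l"
    then obtain l r where r: "strict_mono r" "(a \<circ> r) \<longlonglongrightarrow> l" by blast
    have "bounded (range (a \<circ> r))"
      using r(2) convergent_imp_bounded by blast
    then have "finite {n. a n \<in> range (a \<circ> r)}"
      using a by (simp add: discrete_multiset_def)
    moreover have "range r \<subseteq> {n. a n \<in> range (a \<circ> r)}" by auto
    ultimately have "finite (range r)" by (rule finite_subset[rotated])
    then show False
      using r(1) strict_mono_imp_inj_on range_inj_infinite by blast
  qed
next
  assume n: "\<not> (\<exists>l r. strict_mono r \<and> (a \<circ> r) \<longlonglongrightarrow> l)"
  show "discrete_multiset a"
    unfolding discrete_multiset_def
  proof (intro allI impI, rule ccontr)
    fix B assume B: "bounded B" and "infinite {n. a n \<in> B}"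
    then obtain r :: "nat \<Rightarrow> nat" where r: "strict_mono r" "\<And>n. r n \<in> {n. a n \<in> B}"
      using infinite_enumerate by blast
    have "bounded (range (a \<circ> r))"
      using B r(2) by (intro bounded_subset[OF B]) auto
    then obtain l s where s: "strict_mono s" "((a \<circ> r) \<circ> s) \<longlonglongrightarrow> l"
      using bounded_imp_convergent_subsequence by blast
    then show False
      using n strict_mono_o[OF r(1) s(1)] by (metis comp_assoc)
  qed
qed

lemma discrete_multiset_permute:
  assumes "bij \<pi>"
  shows "discrete_multiset (a \<circ> \<pi>) \<longleftrightarrow> discrete_multiset a"
proof -
  have "finite {n. a (\<pi> n) \<in> B} \<longleftrightarrow> finite {n. a n \<in> B}" for B
  proof -
    have "{n. a (\<pi> n) \<in> B} = \<pi> -` {n. a n \<in> B}" by auto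
    then show ?thesis
      using finite_vimage_iff[OF assms] by metis
  qed
  then show ?thesis by (simp add: discrete_multiset_def)
qed

lemma mset_dist_permute:
  assumes p: "bij \<pi>" and q: "bij \<rho>"
  shows "mset_dist (a \<circ> \<pi>) (b \<circ> \<rho>) = mset_dist a b"
proof -
  have le: "mset_dist (a \<circ> \<pi>) (b \<circ> \<rho>) \<le> mset_dist a b"
    if p: "bij \<pi>" and q: "bij \<rho>" for a b :: "nat \<Rightarrow> 'a" and \<pi> \<rho>
    unfolding mset_dist_def
  proof (rule INF_greatest)
    fix \<sigma> :: "nat \<Rightarrow> nat" assume "\<sigma> \<in> {\<sigma>. bij \<sigma>}"
    then have s: "bij (inv \<rho> \<circ> \<sigma> \<circ> \<pi>)"
      using p q by (intro bij_comp bij_imp_bij_inv) auto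
    have "(SUP n. ennreal (norm ((a \<circ> \<pi>) n - (b \<circ> \<rho>) ((inv \<rho> \<circ> \<sigma> \<circ> \<pi>) n))))
        = (SUP n. ennreal (norm (a (\<pi> n) - b (\<sigma> (\<pi> n)))))"
      using q by (simp add: bij_is_surj surj_f_inv_f)
    also have "\<dots> \<le> (SUP n. ennreal (norm (a n - b (\<sigma> n))))"
      by (intro SUP_least SUP_upper) simp
    finally show "(INF \<sigma>\<in>{\<sigma>. bij \<sigma>}. SUP n. ennreal (norm ((a \<circ> \<pi>) n - (b \<circ> \<rho>) (\<sigma> n))))
        \<le> (SUP n. ennreal (norm (a n - b (\<sigma> n))))"
      using s by (intro INF_lower2[of "inv \<rho> \<circ> \<sigma> \<circ> \<pi>"]) auto
  qed
  have "mset_dist ((a \<circ> \<pi>) \<circ> inv \<pi>) ((b \<circ> \<rho>) \<circ> inv \<rho>) \<le> mset_dist (a \<circ> \<pi>) (b \<circ> \<rho>)"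
    by (intro le bij_imp_bij_inv p q)
  moreover have "(a \<circ> \<pi>) \<circ> inv \<pi> = a" "(b \<circ> \<rho>) \<circ> inv \<rho> = b"
    using p q by (auto simp: fun_eq_iff bij_is_surj surj_f_inv_f)
  ultimately show ?thesis
    using le[OF p q, of a b] by (simp add: antisym)
qed

lemma almost_periodic_permute:
  assumes "bij \<pi>"
  shows "almost_periodic (a \<circ> \<pi>) \<longleftrightarrow> almost_periodic a"
proof -
  have "mset_dist (a \<circ> \<pi>) (\<lambda>n. (a \<circ> \<pi>) n + \<tau>) = mset_dist a (\<lambda>n. a n + \<tau>)" for \<tau>
    using mset_dist_permute[OF assms assms, of a "\<lambda>n. a n + \<tau>"] by (simp add: o_def)
  then show ?thesis by (simp add: almost_periodic_def almost_period_def)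
qed

end

theory Submission
  imports Defs
begin

text \<open>
  The function \<^const>\<open>mset_dist\<close> is an extended pseudometric that is invariant under a common
  translation of both arguments. Therefore an almost period of a nearby set is an almost period
  of \<open>b\<close>, with a slightly worse constant: for every \<open>\<tau>\<close>, the chain
  \<open>b\<close>, \<open>a\<close>, \<open>a + \<tau>\<close>, \<open>b + \<tau>\<close> gives
  \<open>dist(b, b + \<tau>) \<le> dist(a, b) + dist(a, a + \<tau>) + dist(a, b)\<close>. Take \<open>a\<close> to be a member of the
  sequence at distance less than \<open>\<epsilon>/3\<close> from \<open>b\<close>. Every \<open>\<epsilon>/3\<close>-almost period of \<open>a\<close> is then an
  \<open>\<epsilon>\<close>-almost period of \<open>b\<close>, and a superset of a relatively dense set is relatively dense.
\<close>

lemma mset_dist_le: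
  assumes "bij \<sigma>"
  shows "mset_dist a b \<le> (SUP n. ennreal (norm (a n - b (\<sigma> n))))"
  unfolding mset_dist_def using assms by (intro INF_lower) simp

text \<open>A matching read backwards, as the inverse bijection, has the same displacements.\<close>

lemma mset_dist_commute: "mset_dist a b = mset_dist b a"
proof -
  have "mset_dist a b \<le> mset_dist b a" for a b :: "nat \<Rightarrow> 'a"
    unfolding mset_dist_def[of b a]
  proof (rule INF_greatest)
    fix \<sigma> :: "nat \<Rightarrow> nat" assume "\<sigma> \<in> {\<sigma>. bij \<sigma>}"
    then have \<sigma>: "bij \<sigma>" by simp
    have "mset_dist a b \<le> (SUP n. ennreal (norm (a n - b (inv \<sigma> n))))"
      using \<sigma> by (intro mset_dist_le bij_imp_bij_inv)
    also have "\<dots> \<le> (SUP n. ennreal (norm (b n - a (\<sigma> n))))"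
    proof (rule SUP_least)
      fix n
      have "ennreal (norm (a n - b (inv \<sigma> n))) = ennreal (norm (b (inv \<sigma> n) - a (\<sigma> (inv \<sigma> n))))"
        using \<sigma> by (simp add: bij_is_surj surj_f_inv_f norm_minus_commute)
      also have "\<dots> \<le> (SUP n. ennreal (norm (b n - a (\<sigma> n))))"
        by (intro SUP_upper) simp
      finally show "ennreal (norm (a n - b (inv \<sigma> n))) \<le> (SUP n. ennreal (norm (b n - a (\<sigma> n))))" .
    qed
    finally show "mset_dist a b \<le> (SUP n. ennreal (norm (b n - a (\<sigma> n))))" .
  qed
  then show ?thesis by (simp add: antisym)
qed

text \<open>Two matchings compose to a matching whose displacements are bounded by the sums.\<close>

lemma mset_dist_triangle_less:
  assumes "mset_dist a b < x" and "mset_dist b c < y"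
  shows "mset_dist a c < x + y"
proof -
  obtain \<sigma> where \<sigma>: "bij \<sigma>" "(SUP n. ennreal (norm (a n - b (\<sigma> n)))) < x" (is "?S < x")
    using assms(1) unfolding mset_dist_def INF_less_iff by auto
  obtain \<rho> where \<rho>: "bij \<rho>" "(SUP n. ennreal (norm (b n - c (\<rho> n)))) < y" (is "?R < y")
    using assms(2) unfolding mset_dist_def INF_less_iff by auto
  have "mset_dist a c \<le> (SUP n. ennreal (norm (a n - c ((\<rho> \<circ> \<sigma>) n))))"
    by (intro mset_dist_le bij_comp \<sigma> \<rho>)
  also have "\<dots> \<le> ?S + ?R"
  proof (rule SUP_least)
    fix n
    have "norm (a n - c ((\<rho> \<circ> \<sigma>) n)) \<le> norm (a n - b (\<sigma> n)) + norm (b (\<sigma> n) - c (\<rho> (\<sigma> n)))"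
      using norm_triangle_ineq[of "a n - b (\<sigma> n)" "b (\<sigma> n) - c (\<rho> (\<sigma> n))"] by simp
    then have "ennreal (norm (a n - c ((\<rho> \<circ> \<sigma>) n)))
        \<le> ennreal (norm (a n - b (\<sigma> n))) + ennreal (norm (b (\<sigma> n) - c (\<rho> (\<sigma> n))))"
      by (simp flip: ennreal_plus)
    also have "\<dots> \<le> ?S + ?R"
      by (intro add_mono SUP_upper UNIV_I SUP_upper2[of "\<sigma> n"] order_refl)
    finally show "ennreal (norm (a n - c ((\<rho> \<circ> \<sigma>) n))) \<le> ?S + ?R" .
  qed
  also have "\<dots> < x + y"
    using \<sigma>(2) \<rho>(2) by (rule add_strict_mono)
  finally show ?thesis .
qed

lemma mset_dist_translate: "mset_dist (\<lambda>n. a n + \<tau>) (\<lambda>n. b n + \<tau>) = mset_dist a b"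
  by (simp add: mset_dist_def)

lemma almost_period_perturb:
  assumes ab: "mset_dist a b < ennreal \<delta>" and \<tau>: "almost_period \<eta> a \<tau>"
  shows "almost_period (\<delta> + \<eta> + \<delta>) b \<tau>"
proof -
  \<comment> \<open>The strict hypotheses force positivity, since \<open>ennreal\<close> sends negative reals to \<open>0\<close>;
    so \<open>ennreal\<close> is additive on these constants.\<close>
  have pos: "0 < \<delta>" "0 < \<eta>"
    using ab \<tau> le_less_trans[OF zero_le] ennreal_less_zero_iff
    unfolding almost_period_def by blast+
  have "mset_dist b (\<lambda>n. a n + \<tau>) < ennreal \<delta> + ennreal \<eta>"
    using ab \<tau> unfolding almost_period_def
    by (intro mset_dist_triangle_less[of b a]) (simp_all add: mset_dist_commute[of b a])
  then have "mset_dist b (\<lambda>n. b n + \<tau>) < ennreal \<delta> + ennreal \<eta> + ennreal \<delta>"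
    using ab by (rule mset_dist_triangle_less[OF _ mset_dist_translate[THEN ord_eq_less_trans]])
  moreover have "ennreal \<delta> + ennreal \<eta> + ennreal \<delta> = ennreal (\<delta> + \<eta> + \<delta>)"
    using pos by (simp flip: ennreal_plus)
  ultimately show ?thesis
    by (simp only: almost_period_def)
qed

lemma relatively_dense_mono:
  assumes "relatively_dense E" and "E \<subseteq> F"
  shows "relatively_dense F"
  using assms unfolding relatively_dense_def by blast

theorem theorem1:
  fixes D :: "nat \<Rightarrow> nat \<Rightarrow> real ^ 'k" and b :: "nat \<Rightarrow> real ^ 'k"
  assumes "\<And>p. discrete_multiset (D p)"
    and "\<And>p. almost_periodic (D p)"
    and "discrete_multiset b"
    and "(\<lambda>p. mset_dist (D p) b) \<longlonglongrightarrow> 0"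
  shows "almost_periodic b"
  unfolding almost_periodic_def
proof (intro allI impI)
  fix \<epsilon> :: real assume \<epsilon>: "\<epsilon> > 0"
  then have "\<forall>\<^sub>F p in sequentially. mset_dist (D p) b < ennreal (\<epsilon> / 3)"
    by (intro order_tendstoD(2)[OF assms(4)]) simp
  then obtain p where p: "mset_dist (D p) b < ennreal (\<epsilon> / 3)"
    using eventually_happens by force
  have "relatively_dense {\<tau>. almost_period (\<epsilon> / 3) (D p) \<tau>}"
    using assms(2)[of p] \<epsilon> by (simp add: almost_periodic_def)
  moreover have "{\<tau>. almost_period (\<epsilon> / 3) (D p) \<tau>} \<subseteq> {\<tau>. almost_period \<epsilon> b \<tau>}"
    using almost_period_perturb[OF p, of "\<epsilon> / 3"] by auto
  ultimately show "relatively_dense {\<tau>. almost_period \<epsilon> b \<tau>}"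
    by (rule relatively_dense_mono)
qed

end
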